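(* Let $G$ be a Lie group of dimension $n$ with Lie algebra $\mathfrak g$, $H\in\bigwedge^3\mathfrak g^*$ a closed left-invariant three-form and $g$ a left-invariant pseudo-Riemannian metric. The tensor $(\omega_{ABC})$ with $$\omega_{abc}=\tfrac13\mathcal B_{abc},\quad\omega_{ijk}=\tfrac13\mathcal B_{ijk},\quad\omega_{ibc}=\mathcal B_{ibc},\quad\omega_{ajk}=\mathcal B_{ajk}\qquad(a,b,c\in\{1,\dots,n\},\ i,j,k\in\{n+1,\dots,2n\}),$$ all remaining components being zero, defines (via $\omega_{ABC}=\langle D^0_{e_A}e_B,e_C\rangle$) the connection coefficients of a left-invariant Levi-Civita generalized connection $D^0$ of $(G,H,\mathcal G_g)$ with zero divergence, $\delta_{D^0}=0$. The connection $D^0$ does not depend on the choice of the $g$-orthonormal basis $(v_a)$ of $\mathfrak g$ from which the basis $(e_A)$ of $E$ was constructed.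
   Context: Let $E=\mathfrak g\oplus\mathfrak g^*$, with scalar product $\langle X+\xi,Y+\eta\rangle=\frac12(\xi(Y)+\eta(X))$ and Dorfman bracket $[X+\xi,Y+\eta]_H=[X,Y]-\mathrm{ad}_X^*\eta+\mathrm{ad}_Y^*\xi+H(X,Y,\cdot)$, where $\mathrm{ad}_X^*\eta=\eta\circ\mathrm{ad}_X$. Put $gX=g(X,\cdot)$, $\mathcal G_g(X+\xi,Y+\eta)=\frac12(g(X,Y)+g^{-1}(\xi,\eta))$ and $E_\pm=\{X\pm gX:X\in\mathfrak g\}$. For a $g$-orthonormal basis $(v_1,\dots,v_n)$ of $\mathfrak g$ put $e_a=v_a+gv_a$ and $e_{n+a}=v_a-gv_a$, $a=1,\dots,n$; $(e_A)_{A=1,\dots,2n}$ is an orthonormal basis of $E$ adapted to $E=E_+\oplus E_-$. Put $\mathcal B_{ABC}=\langle[e_A,e_B]_H,e_C\rangle$. A left-invariant generalized connection is an element $D\in E^*\otimes\mathfrak{so}(E)$, $u\mapsto D_u$. Its torsion is $T(u,v)=D_uv-D_vu-[u,v]_H+(Du)^*v$, where $Du\in\mathrm{End}(E)$ is $w\mapsto D_wu$ and $*$ is the adjoint for $\langle\cdot,\cdot\rangle$. $D$ is a Levi-Civita generalized connection of $(G,H,\mathcal G_g)$ if $T=0$ and $D_uE_\pm\subset E_\pm$ for all $u$. Its divergence is $\delta_D\in E^*$, $\delta_D(v)=\mathrm{tr}(u\mapsto D_uv)$. *)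

theory Defs
  imports "HOL-Analysis.Analysis"
begin

section \<open>The algebraic dual of a real vector space\<close>

typedef (overloaded) 'a dual = "{f :: 'a::real_vector \<Rightarrow> real. linear f}"
  morphisms dual_apply Dual
  by (rule exI[of _ "\<lambda>_. 0"]) (simp add: linear_zero)

setup_lifting type_definition_dual

instantiation dual :: (real_vector) real_vector
begin

lift_definition zero_dual :: "'a dual" is "\<lambda>_. 0"
  by (rule linear_zero)

lift_definition plus_dual :: "'a dual \<Rightarrow> 'a dual \<Rightarrow> 'a dual" is "\<lambda>f g x. f x + g x"
  by (rule linear_compose_add)

lift_definition minus_dual :: "'a dual \<Rightarrow> 'a dual \<Rightarrow> 'a dual" is "\<lambda>f g x. f x - g x"
  by (rule linear_compose_sub)

lift_definition uminus_dual :: "'a dual \<Rightarrow> 'a dual" is "\<lambda>f x. - f x"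
  by (rule linear_compose_neg)

lift_definition scaleR_dual :: "real \<Rightarrow> 'a dual \<Rightarrow> 'a dual" is "\<lambda>c f x. c *\<^sub>R f x"
  by (rule linear_compose_scale_right)

instance
  by standard (transfer; force simp: algebra_simps)+

end

lemma linear_dual_apply: "linear (dual_apply \<xi>)"
  using dual_apply by auto

lemma dual_apply_Dual: "linear f \<Longrightarrow> dual_apply (Dual f) = f"
  by (simp add: Dual_inverse)

section \<open>Trace of an endomorphism\<close>

text \<open>The trace is computed in the fixed basis \<open>extend_basis {}\<close> of the whole space; for linear maps
  of finite-dimensional spaces the value does not depend on this choice.\<close>

definition lin_trace :: "('a::real_vector \<Rightarrow> 'a) \<Rightarrow> real" where
  "lin_trace f = (\<Sum>b\<in>extend_basis {}. representation (extend_basis {}) (f b) b)"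

section \<open>Left-invariant data on a Lie group, expressed on its Lie algebra\<close>

definition lie_bracket :: "('a::real_vector \<Rightarrow> 'a \<Rightarrow> 'a) \<Rightarrow> bool" where
  "lie_bracket br \<longleftrightarrow> bilinear br \<and> (\<forall>X. br X X = 0) \<and>
     (\<forall>X Y Z. br X (br Y Z) + br Y (br Z X) + br Z (br X Y) = 0)"

definition three_form :: "('a::real_vector \<Rightarrow> 'a \<Rightarrow> 'a \<Rightarrow> real) \<Rightarrow> bool" where
  "three_form H \<longleftrightarrow>
     (\<forall>Y Z. linear (\<lambda>X. H X Y Z)) \<and> (\<forall>X Z. linear (\<lambda>Y. H X Y Z)) \<and> (\<forall>X Y. linear (\<lambda>Z. H X Y Z)) \<and>
     (\<forall>X Y Z. H Y X Z = - H X Y Z) \<and> (\<forall>X Y Z. H X Z Y = - H X Y Z)"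

text \<open>Exterior derivative of a left-invariant three-form, evaluated on left-invariant vector fields:
  all derivatives of component functions vanish and only the bracket terms of the Koszul formula
  \<open>\<Sum>i<j. (-1)^(i+j) H([X\<^sub>i, X\<^sub>j], \<dots>)\<close> survive.\<close>

definition ext_deriv3 ::
    "('a::real_vector \<Rightarrow> 'a \<Rightarrow> 'a) \<Rightarrow> ('a \<Rightarrow> 'a \<Rightarrow> 'a \<Rightarrow> real) \<Rightarrow> 'a \<Rightarrow> 'a \<Rightarrow> 'a \<Rightarrow> 'a \<Rightarrow> real" where
  "ext_deriv3 br H X Y Z W =
     - H (br X Y) Z W + H (br X Z) Y W - H (br X W) Y Z
     - H (br Y Z) X W + H (br Y W) X Z - H (br Z W) X Y"

definition closed_three_form ::
    "('a::real_vector \<Rightarrow> 'a \<Rightarrow> 'a) \<Rightarrow> ('a \<Rightarrow> 'a \<Rightarrow> 'a \<Rightarrow> real) \<Rightarrow> bool" where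
  "closed_three_form br H \<longleftrightarrow> three_form H \<and> (\<forall>X Y Z W. ext_deriv3 br H X Y Z W = 0)"

definition pseudo_metric :: "('a::real_vector \<Rightarrow> 'a \<Rightarrow> real) \<Rightarrow> bool" where
  "pseudo_metric g \<longleftrightarrow> bilinear g \<and> (\<forall>X Y. g X Y = g Y X) \<and> (\<forall>X. (\<forall>Y. g X Y = 0) \<longrightarrow> X = 0)"

section \<open>The quadratic Lie algebra of left-invariant sections of the generalized tangent bundle\<close>

type_synonym 'a gen = "'a \<times> 'a dual"

definition pairing :: "'a::real_vector gen \<Rightarrow> 'a gen \<Rightarrow> real" where
  "pairing u v = (dual_apply (snd u) (fst v) + dual_apply (snd v) (fst u)) / 2"

definition ad_star :: "('a::real_vector \<Rightarrow> 'a \<Rightarrow> 'a) \<Rightarrow> 'a \<Rightarrow> 'a dual \<Rightarrow> 'a dual" where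
  "ad_star br X \<eta> = Dual (dual_apply \<eta> \<circ> br X)"

definition dorfman ::
    "('a::real_vector \<Rightarrow> 'a \<Rightarrow> 'a) \<Rightarrow> ('a \<Rightarrow> 'a \<Rightarrow> 'a \<Rightarrow> real) \<Rightarrow> 'a gen \<Rightarrow> 'a gen \<Rightarrow> 'a gen" where
  "dorfman br H u v =
     (br (fst u) (fst v),
      - ad_star br (fst u) (snd v) + ad_star br (fst v) (snd u) + Dual (H (fst u) (fst v)))"

definition flat :: "('a::real_vector \<Rightarrow> 'a \<Rightarrow> real) \<Rightarrow> 'a \<Rightarrow> 'a dual" where
  "flat g X = Dual (g X)"

definition E_plus :: "('a::real_vector \<Rightarrow> 'a \<Rightarrow> real) \<Rightarrow> 'a gen set" where
  "E_plus g = {(X, flat g X) | X. True}"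

definition E_minus :: "('a::real_vector \<Rightarrow> 'a \<Rightarrow> real) \<Rightarrow> 'a gen set" where
  "E_minus g = {(X, - flat g X) | X. True}"

section \<open>Generalized connections\<close>

text \<open>An element \<open>D\<close> of \<open>E* \<otimes> so(E)\<close> is represented by the bilinear map \<open>(u, v) \<mapsto> D\<^sub>u v\<close>, written \<open>D u v\<close>.\<close>

definition gen_connection :: "('a::real_vector gen \<Rightarrow> 'a gen \<Rightarrow> 'a gen) \<Rightarrow> bool" where
  "gen_connection D \<longleftrightarrow> bilinear D \<and> (\<forall>u v w. pairing (D u v) w = - pairing v (D u w))"

text \<open>The library constant \<open>adjoint\<close> refers to a positive definite inner product; here the adjoint is
  taken with respect to the indefinite scalar product \<open>pairing\<close>.\<close>

definition pairing_adjoint :: "('a::real_vector gen \<Rightarrow> 'a gen) \<Rightarrow> 'a gen \<Rightarrow> 'a gen" where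
  "pairing_adjoint A = (THE B. \<forall>u v. pairing (A u) v = pairing u (B v))"

definition torsion ::
    "('a::real_vector \<Rightarrow> 'a \<Rightarrow> 'a) \<Rightarrow> ('a \<Rightarrow> 'a \<Rightarrow> 'a \<Rightarrow> real) \<Rightarrow> ('a gen \<Rightarrow> 'a gen \<Rightarrow> 'a gen)
      \<Rightarrow> 'a gen \<Rightarrow> 'a gen \<Rightarrow> 'a gen" where
  "torsion br H D u v = D u v - D v u - dorfman br H u v + pairing_adjoint (\<lambda>w. D w u) v"

definition levi_civita ::
    "('a::real_vector \<Rightarrow> 'a \<Rightarrow> 'a) \<Rightarrow> ('a \<Rightarrow> 'a \<Rightarrow> 'a \<Rightarrow> real) \<Rightarrow> ('a \<Rightarrow> 'a \<Rightarrow> real)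
      \<Rightarrow> ('a gen \<Rightarrow> 'a gen \<Rightarrow> 'a gen) \<Rightarrow> bool" where
  "levi_civita br H g D \<longleftrightarrow> gen_connection D \<and> (\<forall>u v. torsion br H D u v = 0) \<and>
     (\<forall>u. D u ` E_plus g \<subseteq> E_plus g) \<and> (\<forall>u. D u ` E_minus g \<subseteq> E_minus g)"

definition divergence :: "('a::real_vector gen \<Rightarrow> 'a gen \<Rightarrow> 'a gen) \<Rightarrow> 'a gen \<Rightarrow> real" where
  "divergence D v = lin_trace (\<lambda>u. D u v)"

section \<open>Adapted orthonormal bases and the canonical coefficients\<close>

text \<open>Only the values \<open>v 1, \<dots>, v n\<close> are relevant.\<close>

definition orthonormal_basis :: "nat \<Rightarrow> ('a::real_vector \<Rightarrow> 'a \<Rightarrow> real) \<Rightarrow> (nat \<Rightarrow> 'a) \<Rightarrow> bool" where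
  "orthonormal_basis n g v \<longleftrightarrow>
     inj_on v {1..n} \<and> independent (v ` {1..n}) \<and> span (v ` {1..n}) = UNIV \<and>
     (\<forall>a\<in>{1..n}. g (v a) (v a) = 1 \<or> g (v a) (v a) = -1) \<and>
     (\<forall>a\<in>{1..n}. \<forall>b\<in>{1..n}. a \<noteq> b \<longrightarrow> g (v a) (v b) = 0)"

definition adapted_basis ::
    "nat \<Rightarrow> ('a::real_vector \<Rightarrow> 'a \<Rightarrow> real) \<Rightarrow> (nat \<Rightarrow> 'a) \<Rightarrow> nat \<Rightarrow> 'a gen" where
  "adapted_basis n g v A =
     (if A \<le> n then (v A, flat g (v A)) else (v (A - n), - flat g (v (A - n))))"

definition bracket_coeff ::
    "('a::real_vector \<Rightarrow> 'a \<Rightarrow> 'a) \<Rightarrow> ('a \<Rightarrow> 'a \<Rightarrow> 'a \<Rightarrow> real) \<Rightarrow> (nat \<Rightarrow> 'a gen)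
      \<Rightarrow> nat \<Rightarrow> nat \<Rightarrow> nat \<Rightarrow> real" where
  "bracket_coeff br H e A B C = pairing (dorfman br H (e A) (e B)) (e C)"

definition omega ::
    "nat \<Rightarrow> ('a::real_vector \<Rightarrow> 'a \<Rightarrow> 'a) \<Rightarrow> ('a \<Rightarrow> 'a \<Rightarrow> 'a \<Rightarrow> real) \<Rightarrow> (nat \<Rightarrow> 'a gen)
      \<Rightarrow> nat \<Rightarrow> nat \<Rightarrow> nat \<Rightarrow> real" where
  "omega n br H e A B C =
     (let P = {1..n}; M = {n+1..2*n} in
      if A \<in> P \<and> B \<in> P \<and> C \<in> P \<or> A \<in> M \<and> B \<in> M \<and> C \<in> M then bracket_coeff br H e A B C / 3
      else if A \<in> M \<and> B \<in> P \<and> C \<in> P \<or> A \<in> P \<and> B \<in> M \<and> C \<in> M then bracket_coeff br H e A B C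
      else 0)"

text \<open>\<open>D\<close> is the (a priori only bilinear) map whose coefficients in the adapted basis built from \<open>v\<close>
  are the \<open>omega\<close>; skew-symmetry of \<open>D\<^sub>u\<close> is not presupposed.\<close>

definition has_omega_coeffs ::
    "nat \<Rightarrow> ('a::real_vector \<Rightarrow> 'a \<Rightarrow> 'a) \<Rightarrow> ('a \<Rightarrow> 'a \<Rightarrow> 'a \<Rightarrow> real) \<Rightarrow> ('a \<Rightarrow> 'a \<Rightarrow> real) \<Rightarrow> (nat \<Rightarrow> 'a)
      \<Rightarrow> ('a gen \<Rightarrow> 'a gen \<Rightarrow> 'a gen) \<Rightarrow> bool" where
  "has_omega_coeffs n br H g v D \<longleftrightarrow> bilinear D \<and>
     (let e = adapted_basis n g v in
      \<forall>A\<in>{1..2*n}. \<forall>B\<in>{1..2*n}. \<forall>C\<in>{1..2*n}.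
        pairing (D (e A) (e B)) (e C) = omega n br H e A B C)"

end

theory Submission
  imports Defs
begin

text \<open>With \<open>B u v w = \<langle>[u, v]\<^sub>H, w\<rangle>\<close>, an alternating trilinear form on \<open>E\<close>, and the orthogonal
  projections \<open>p\<close>, \<open>m\<close> of \<open>E\<close> onto \<open>E\<^sub>+\<close>, \<open>E\<^sub>-\<close>, the given coefficients are those of the form
  \<open>B (p u) (p v) (p w) / 3 + B (m u) (m v) (m w) / 3 + B (m u) (p v) (p w) + B (p u) (m v) (m w)\<close>.
  This description mentions no basis, so the connection does not depend on one, and it gives
  \<open>D\<^sub>u v\<close> as a combination of projected brackets. Torsion-freeness is then the identity
  \<open>\<omega>(u,v,w) + \<omega>(v,w,u) + \<omega>(w,u,v) = B u v w\<close>, and the trace of \<open>u \<mapsto> D\<^sub>u v\<close> is a combination of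
  terms \<open>\<omega>(e\<^sub>A, v, e\<^sub>A)\<close>, which vanish because \<open>B\<close> is alternating.\<close>

section \<open>The dual space and the trace\<close>

lemmas dual_apply_simps [simp] =
  zero_dual.rep_eq plus_dual.rep_eq minus_dual.rep_eq uminus_dual.rep_eq scaleR_dual.rep_eq

lemma dual_eqI: "(\<And>x. dual_apply \<xi> x = dual_apply \<eta> x) \<Longrightarrow> \<xi> = \<eta>"
  by (metis dual_apply_inject ext)

lemmas dual_apply_linear_simps [simp] =
  linear_add[OF linear_dual_apply] linear_diff[OF linear_dual_apply]
  linear_neg[OF linear_dual_apply] linear_cmul[OF linear_dual_apply] linear_0[OF linear_dual_apply]

text \<open>Expanding \<open>f b\<close> over the \<open>e i\<close>, and each \<open>e i\<close>
  over the reference basis, produces the same double sum in two orders. The spanning family also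
  forces the reference basis to be finite; over an infinite one the sum would take the default value
  0.\<close>

lemma lin_trace_dual_frame:
  fixes f :: "'a::real_vector \<Rightarrow> 'a"
  assumes "finite I" and f: "linear f" and \<phi>: "\<And>i. i \<in> I \<Longrightarrow> linear (\<phi> i)"
    and expand: "\<And>x. x = (\<Sum>i\<in>I. \<phi> i x *\<^sub>R e i)"
  shows "lin_trace f = (\<Sum>i\<in>I. \<phi> i (f (e i)))"
proof -
  define B where "B = (extend_basis {} :: 'a set)"
  have ind: "independent B" and sp: "span B = UNIV"
    unfolding B_def using independent_extend_basis[OF independent_empty] span_extend_basis[OF independent_empty]
    by simp_all
  have "x \<in> span (e ` I)" for x
    by (subst expand) (blast intro: span_sum span_scale span_base)
  then have finB: "finite B"
    using independent_span_bound[of "e ` I" B] ind \<open>finite I\<close> by auto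
  have rep: "representation B (f b) b = (\<Sum>i\<in>I. \<phi> i (f b) * representation B (e i) b)" for b
  proof -
    have "representation B (\<Sum>i\<in>I. \<phi> i (f b) *\<^sub>R e i) b = (\<Sum>i\<in>I. \<phi> i (f b) * representation B (e i) b)"
      using ind sp by (simp add: representation_sum representation_scale)
    then show ?thesis using expand[of "f b"] by simp
  qed
  have "(\<Sum>b\<in>B. \<phi> i (f b) * representation B (e i) b) = \<phi> i (f (e i))" if "i \<in> I" for i
  proof -
    have "e i = (\<Sum>b\<in>B. representation B (e i) b *\<^sub>R b)"
      using ind sp finB by (simp add: sum_representation_eq)
    then have "\<phi> i (f (e i)) = \<phi> i (f (\<Sum>b\<in>B. representation B (e i) b *\<^sub>R b))" by simp
    also have "\<dots> = (\<Sum>b\<in>B. representation B (e i) b * \<phi> i (f b))"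
      using f \<phi>[OF that] by (simp add: linear_sum linear_cmul)
    finally show ?thesis by (simp add: mult.commute)
  qed
  then show ?thesis
    unfolding lin_trace_def B_def[symmetric] rep
    by (subst sum.swap) simp
qed

section \<open>The scalar product\<close>

lemma pairing_commute: "pairing u v = pairing v u"
  by (simp add: pairing_def add.commute)

lemma pairing_add_left: "pairing (u + u') v = pairing u v + pairing u' v"
  and pairing_diff_left: "pairing (u - u') v = pairing u v - pairing u' v"
  and pairing_scale_left: "pairing (c *\<^sub>R u) v = c * pairing u v"
  and pairing_zero_left [simp]: "pairing 0 v = 0"
  by (simp_all add: pairing_def field_simps)

lemma pairing_add_right: "pairing v (u + u') = pairing v u + pairing v u'"
  and pairing_scale_right: "pairing v (c *\<^sub>R u) = c * pairing v u"
  and pairing_zero_right [simp]: "pairing v 0 = 0"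
  by (simp_all add: pairing_def field_simps)

lemmas pairing_simps = pairing_add_left pairing_diff_left pairing_scale_left
  pairing_add_right pairing_scale_right

text \<open>Each \<open>g (v a) (v a)\<close> is 1 or -1, hence its own inverse, so it serves as a
  coefficient without division. Both sides are linear in \<open>X\<close> and agree on the
  basis.\<close>

lemma orthonormal_expansion:
  assumes g: "pseudo_metric g" and v: "orthonormal_basis n g v"
  shows "X = (\<Sum>a\<in>{1..n}. (g (v a) (v a) * g X (v a)) *\<^sub>R v a)"
proof (rule linear_eq_on_span[where f = id and B = "v ` {1..n}", simplified id_apply])
  have g': "bilinear g" using g by (simp add: pseudo_metric_def)
  show "linear (\<lambda>X. \<Sum>a\<in>{1..n}. (g (v a) (v a) * g X (v a)) *\<^sub>R v a)"
    by (rule linearI; simp add: bilinear_ladd[OF g'] bilinear_lmul[OF g']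
        sum.distrib algebra_simps scaleR_sum_right)
  show "X \<in> span (v ` {1..n})"
    using v by (simp add: orthonormal_basis_def)
  fix x assume "x \<in> v ` {1..n}"
  then obtain b where b: "b \<in> {1..n}" "x = v b" by blast
  have "g (v b) (v b) = 1 \<or> g (v b) (v b) = -1"
    using v b(1) unfolding orthonormal_basis_def by blast
  then have "g (v b) (v b) * g (v b) (v b) = 1" by auto
  then have "(\<Sum>a\<in>{1..n}. (g (v a) (v a) * g (v b) (v a)) *\<^sub>R v a)
      = (\<Sum>a\<in>{1..n}. if a = b then v b else 0)"
    using v b(1) by (intro sum.cong) (auto simp: orthonormal_basis_def)
  then show "x = (\<Sum>a\<in>{1..n}. (g (v a) (v a) * g x (v a)) *\<^sub>R v a)"
    using b by simp
qed (simp add: linear_id)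

text \<open>This supplies the locale assumption below, which lets the connection be built without
  choosing a basis. The preimage comes from the expansion of \<open>X\<close> by putting the values
  of \<xi> in place of \<open>g X (v a)\<close>.\<close>

lemma surj_flat:
  assumes g: "pseudo_metric g" and v: "orthonormal_basis n g v"
  shows "surj (flat g)"
proof (rule surjI)
  fix \<xi>
  have g': "bilinear g" and sym: "g X Y = g Y X" for X Y
    using g by (simp_all add: pseudo_metric_def)
  let ?X = "\<Sum>a\<in>{1..n}. (g (v a) (v a) * dual_apply \<xi> (v a)) *\<^sub>R v a"
  show "flat g ?X = \<xi>"
  proof (rule dual_eqI)
    fix Y
    have lin: "linear (\<lambda>X. g X Y)" "linear (g X)" for X
      using g' by (simp_all add: bilinear_def)
    have "dual_apply (flat g ?X) Y = (\<Sum>a\<in>{1..n}. g (v a) (v a) * g Y (v a) * dual_apply \<xi> (v a))"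
      using lin by (simp add: flat_def dual_apply_Dual linear_sum[OF lin(1)] linear_cmul[OF lin(1)]
          sym[of "v _" Y] mult_ac)
    also have "\<dots> = dual_apply \<xi> (\<Sum>a\<in>{1..n}. (g (v a) (v a) * g Y (v a)) *\<^sub>R v a)"
      by (simp add: linear_sum[OF linear_dual_apply])
    also have "\<dots> = dual_apply \<xi> Y"
      by (simp only: orthonormal_expansion[OF g v, symmetric])
    finally show "dual_apply (flat g ?X) Y = dual_apply \<xi> Y" .
  qed
qed

section \<open>The generalized tangent algebra of a fixed metric\<close>

locale left_invariant_data =
  fixes br :: "'a::real_vector \<Rightarrow> 'a \<Rightarrow> 'a" and H :: "'a \<Rightarrow> 'a \<Rightarrow> 'a \<Rightarrow> real"
    and g :: "'a \<Rightarrow> 'a \<Rightarrow> real"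
  assumes bilinear_br: "bilinear br" and br_self: "br X X = 0"
    and three_form: "three_form H"
    and metric: "pseudo_metric g"
    and surj_flat: "surj (flat g)"
begin

lemma bilinear_g: "bilinear g" and g_commute: "g X Y = g Y X"
  and g_nondegenerate: "(\<And>Y. g X Y = 0) \<Longrightarrow> X = 0"
  using metric by (auto simp: pseudo_metric_def)

lemma br_skew: "br X Y = - br Y X"
proof -
  have "br X Y + br Y X = br (X + Y) (X + Y)"
    by (simp only: bilinear_ladd[OF bilinear_br] bilinear_radd[OF bilinear_br])
      (simp add: br_self)
  then have "br X Y + br Y X = 0" by (simp only: br_self)
  then show ?thesis by (simp add: eq_neg_iff_add_eq_0)
qed

lemma dual_apply_flat [simp]: "dual_apply (flat g X) Y = g X Y"
  using bilinear_g by (simp add: flat_def dual_apply_Dual bilinear_def)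

lemma linear_flat: "linear (flat g)"
  by (auto intro!: linearI dual_eqI simp: bilinear_ladd[OF bilinear_g] bilinear_lmul[OF bilinear_g])

lemma inj_flat: "inj (flat g)"
proof (rule injI)
  fix X Y assume "flat g X = flat g Y"
  then have "g (X - Y) Z = 0" for Z
    by (metis dual_apply_flat bilinear_lsub[OF bilinear_g] right_minus_eq)
  then show "X = Y" using g_nondegenerate[of "X - Y"] by simp
qed

text \<open>Stated for two vectors so that it acts as an extensionality rule, reducing equations in
  \<open>E\<close> to scalar identities. Covectors of the form \<open>flat g Y\<close> suffice as
  tests for the vector part.\<close>

lemma pairing_nondegenerate:
  fixes u u' :: "'a gen"
  assumes "\<And>w. pairing u w = pairing u' w"
  shows "u = u'"
proof -
  obtain X \<xi> where u: "u - u' = (X, \<xi>)" by (cases "u - u'")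
  have 0: "pairing (X, \<xi>) w = 0" for w
    by (simp add: u[symmetric] pairing_diff_left assms)
  have "\<xi> = 0"
    by (rule dual_eqI) (use 0[of "(_, 0)"] in \<open>simp add: pairing_def\<close>)
  moreover have "X = 0"
    by (rule g_nondegenerate) (use 0[of "(0, flat g _)"] in \<open>simp add: pairing_def g_commute\<close>)
  ultimately show ?thesis using u by (simp add: zero_prod_def[symmetric])
qed

text \<open>Nondegeneracy gives uniqueness, so exhibiting any adjoint settles the \<open>THE\<close>
  in the definition.\<close>

lemma pairing_adjointI:
  fixes A A' :: "'a gen \<Rightarrow> 'a gen"
  assumes "\<And>u v. pairing (A u) v = pairing u (A' v)"
  shows "pairing_adjoint A = A'"
  unfolding pairing_adjoint_def
proof (rule the_equality)
  fix C assume "\<forall>u v. pairing (A u) v = pairing u (C v)"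
  then have "pairing (C v) u = pairing (A' v) u" for u v
    by (metis assms pairing_commute)
  then have "C v = A' v" for v by (intro pairing_nondegenerate)
  then show "C = A'" by (rule ext)
qed (use assms in auto)

subsection \<open>The bracket form\<close>

definition bracket_form :: "'a gen \<Rightarrow> 'a gen \<Rightarrow> 'a gen \<Rightarrow> real" where
  "bracket_form u v w = pairing (dorfman br H u v) w"

text \<open>In this form the skew-symmetries are visible: exchanging neighbouring arguments permutes
  the three bracket terms with a change of sign.\<close>

lemma bracket_form_eq:
  "bracket_form u v w =
    (dual_apply (snd w) (br (fst u) (fst v)) - dual_apply (snd v) (br (fst u) (fst w))
      + dual_apply (snd u) (br (fst v) (fst w)) + H (fst u) (fst v) (fst w)) / 2"
proof -
  have "linear (dual_apply \<xi> \<circ> br X)" for \<xi> X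
    using bilinear_br by (intro linear_compose linear_dual_apply) (simp add: bilinear_def eta_contract_eq)
  then have ad: "dual_apply (ad_star br X \<xi>) Y = dual_apply \<xi> (br X Y)" for X Y \<xi>
    by (simp add: ad_star_def dual_apply_Dual)
  have "linear (H X Y)" for X Y
    using three_form unfolding three_form_def by metis
  then show ?thesis
    by (simp add: bracket_form_def pairing_def dorfman_def ad dual_apply_Dual)
qed

lemma linear_bracket_form: "linear (\<lambda>w. bracket_form u v w)"
  by (rule linearI; simp add: bracket_form_def pairing_simps)

lemma bracket_form_swap12: "bracket_form v u w = - bracket_form u v w"
  and bracket_form_swap23: "bracket_form u w v = - bracket_form u v w"
proof -
  have H: "H Y X Z = - H X Y Z" "H X Z Y = - H X Y Z" for X Y Z
    using three_form unfolding three_form_def by metis+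
  show "bracket_form v u w = - bracket_form u v w"
    using br_skew[of "fst v" "fst u"] H(1)[of "fst v" "fst u"] by (simp add: bracket_form_eq field_simps)
  show "bracket_form u w v = - bracket_form u v w"
    using br_skew[of "fst w" "fst v"] H(2)[of "fst u" "fst w" "fst v"]
    by (simp add: bracket_form_eq field_simps)
qed

lemma bracket_form_cyclic: "bracket_form v w u = bracket_form u v w"
  by (metis bracket_form_swap12 bracket_form_swap23 minus_minus)

lemma bracket_form_self13: "bracket_form u v u = 0"
  using bracket_form_swap12[of u v u] bracket_form_swap23[of u u v] bracket_form_swap12[of u u v]
  by simp

text \<open>Linearity in the last slot of the bracket form comes from the pairing alone. Cyclic
  symmetry carries it to the other two slots, and nondegeneracy then removes the pairing.\<close>

lemma bilinear_dorfman: "bilinear (dorfman br H)"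
proof -
  have lin3: "linear (\<lambda>u. bracket_form u v w)" for v w
    using linear_bracket_form[of v w] by (simp add: bracket_form_cyclic)
  have lin2: "linear (\<lambda>v. bracket_form u v w)" for u w
    using linear_bracket_form[of w u] by (simp add: bracket_form_cyclic[of u _ w])
  show ?thesis
    unfolding bilinear_def
    by (intro conjI allI linearI; rule pairing_nondegenerate; simp add: pairing_simps
      linear_add[OF lin2[unfolded bracket_form_def]] linear_cmul[OF lin2[unfolded bracket_form_def]]
      linear_add[OF lin3[unfolded bracket_form_def]] linear_cmul[OF lin3[unfolded bracket_form_def]])
qed

lemmas dorfman_zero [simp] = bilinear_lzero[OF bilinear_dorfman] bilinear_rzero[OF bilinear_dorfman]

lemma bracket_form_add:
  "bracket_form (u + u') v w = bracket_form u v w + bracket_form u' v w"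
  "bracket_form u (v + v') w = bracket_form u v w + bracket_form u v' w"
  "bracket_form u v (w + w') = bracket_form u v w + bracket_form u v w'"
  by (simp_all add: bracket_form_def pairing_simps bilinear_ladd[OF bilinear_dorfman]
      bilinear_radd[OF bilinear_dorfman])

lemma bracket_form_zero [simp]:
  "bracket_form 0 v w = 0" "bracket_form u 0 w = 0" "bracket_form u v 0 = 0"
  by (simp_all add: bracket_form_def)

subsection \<open>The orthogonal splitting\<close>

definition sharp :: "'a dual \<Rightarrow> 'a" where
  "sharp = inv (flat g)"

lemma flat_sharp [simp]: "flat g (sharp \<xi>) = \<xi>" and sharp_flat [simp]: "sharp (flat g X) = X"
  by (simp_all add: sharp_def surj_f_inv_f[OF surj_flat] inv_f_f[OF inj_flat])

lemma linear_sharp: "linear sharp"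
  by (rule linearI; rule injD[OF inj_flat]; simp add: linear_add[OF linear_flat] linear_cmul[OF linear_flat])

text \<open>The formulas for both projections solve
  \<open>(X, \<xi>) = (Y, flat g Y) + (Z, - flat g Z)\<close> for \<open>Y\<close> and
  \<open>Z\<close>.\<close>

definition proj_plus :: "'a gen \<Rightarrow> 'a gen" where
  "proj_plus u = (let X = (1/2) *\<^sub>R (fst u + sharp (snd u)) in (X, flat g X))"

definition proj_minus :: "'a gen \<Rightarrow> 'a gen" where
  "proj_minus u = (let X = (1/2) *\<^sub>R (fst u - sharp (snd u)) in (X, - flat g X))"

lemmas linear_simps = linear_add[OF linear_flat] linear_cmul[OF linear_flat] linear_diff[OF linear_flat]
  linear_neg[OF linear_flat] linear_0[OF linear_flat]
  linear_add[OF linear_sharp] linear_cmul[OF linear_sharp] linear_diff[OF linear_sharp]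
  linear_neg[OF linear_sharp]

lemma linear_proj_plus: "linear proj_plus" and linear_proj_minus: "linear proj_minus"
  by ((rule linearI; simp add: proj_plus_def proj_minus_def Let_def linear_simps algebra_simps)+)

lemma proj_plus_E_plus [simp]: "proj_plus (X, flat g X) = (X, flat g X)"
  and proj_minus_E_plus [simp]: "proj_minus (X, flat g X) = 0"
  and proj_plus_E_minus [simp]: "proj_plus (X, - flat g X) = 0"
  and proj_minus_E_minus [simp]: "proj_minus (X, - flat g X) = (X, - flat g X)"
  by (simp_all add: proj_plus_def proj_minus_def Let_def linear_simps zero_prod_def
      scaleR_2[symmetric] algebra_simps flip: scaleR_add_left)

lemma proj_plus_in: "proj_plus u \<in> E_plus g" and proj_minus_in: "proj_minus u \<in> E_minus g"
  by (auto simp: E_plus_def E_minus_def proj_plus_def proj_minus_def Let_def)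

lemma proj_add: "proj_plus u + proj_minus u = u"
  by (simp add: proj_plus_def proj_minus_def Let_def linear_simps prod_eq_iff algebra_simps flip: scaleR_add_left)

lemma pairing_plus_minus: "pairing (proj_plus u) (proj_minus w) = 0"
  by (simp add: proj_plus_def proj_minus_def Let_def pairing_def g_commute[of "_ *\<^sub>R (fst w - _)"]
      bilinear_rsub[OF bilinear_g] bilinear_rmul[OF bilinear_g])

text \<open>By orthogonality of the splitting, both sides equal the pairing of
  \<open>proj_plus u\<close> with \<open>proj_plus w\<close>.\<close>

lemma pairing_proj_plus: "pairing (proj_plus u) w = pairing u (proj_plus w)"
  by (metis (no_types) add.right_neutral pairing_add_left pairing_add_right pairing_commute
      pairing_plus_minus proj_add)

lemma pairing_proj_minus: "pairing (proj_minus u) w = pairing u (proj_minus w)"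
  by (metis (no_types) add.left_neutral pairing_add_left pairing_add_right pairing_commute
      pairing_plus_minus proj_add)

subsection \<open>The canonical connection\<close>

definition canonical_form :: "'a gen \<Rightarrow> 'a gen \<Rightarrow> 'a gen \<Rightarrow> real" where
  "canonical_form u v w =
     bracket_form (proj_plus u) (proj_plus v) (proj_plus w) / 3
   + bracket_form (proj_minus u) (proj_minus v) (proj_minus w) / 3
   + bracket_form (proj_minus u) (proj_plus v) (proj_plus w)
   + bracket_form (proj_plus u) (proj_minus v) (proj_minus w)"

text \<open>Found by moving the projection of \<open>w\<close> in
  \<open>canonical_form u v w\<close> to the other side of the pairing and grouping the terms by
  that projection.\<close>

definition canonical_connection :: "'a gen \<Rightarrow> 'a gen \<Rightarrow> 'a gen" where
  "canonical_connection u v =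
     proj_plus (dorfman br H ((1/3) *\<^sub>R proj_plus u + proj_minus u) (proj_plus v))
   + proj_minus (dorfman br H (proj_plus u + (1/3) *\<^sub>R proj_minus u) (proj_minus v))"

lemma pairing_canonical_connection: "pairing (canonical_connection u v) w = canonical_form u v w"
  by (simp add: canonical_connection_def canonical_form_def pairing_add_left pairing_proj_plus
      pairing_proj_minus pairing_scale_left bracket_form_def
      bilinear_ladd[OF bilinear_dorfman] bilinear_lmul[OF bilinear_dorfman])

lemma bilinear_canonical_connection: "bilinear canonical_connection"
  unfolding bilinear_def
  by (intro conjI allI linearI; simp add: canonical_connection_def
      linear_add[OF linear_proj_plus] linear_cmul[OF linear_proj_plus]
      linear_add[OF linear_proj_minus] linear_cmul[OF linear_proj_minus]
      bilinear_ladd[OF bilinear_dorfman] bilinear_lmul[OF bilinear_dorfman]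
      bilinear_radd[OF bilinear_dorfman] bilinear_rmul[OF bilinear_dorfman] algebra_simps)

lemma canonical_form_swap23: "canonical_form u w v = - canonical_form u v w"
  by (simp add: canonical_form_def bracket_form_swap23[of _ "_ w" "_ v"])

text \<open>Splitting every argument gives eight components. The two pure ones occur in all three
  summands, with weight 1/3 each. Each of the six mixed ones occurs in exactly one summand, the one
  whose first argument is of the minority type.\<close>

lemma canonical_form_cyclic_sum:
  "canonical_form u v w + canonical_form v w u + canonical_form w u v = bracket_form u v w"
proof -
  have split: "bracket_form u v w =
      bracket_form (proj_plus u + proj_minus u) (proj_plus v + proj_minus v) (proj_plus w + proj_minus w)"
    by (simp add: proj_add)
  show ?thesis
    unfolding split canonical_form_def
    by (simp add: bracket_form_add bracket_form_cyclic[of "_ v" "_ w" "_ u"]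
        bracket_form_cyclic[of "_ w" "_ u" "_ v"])
qed

lemma torsion_canonical_connection: "torsion br H canonical_connection u v = 0"
proof (rule pairing_nondegenerate)
  fix w
  \<comment> \<open>\<open>A\<close> is the adjoint of \<open>x \<mapsto> D\<^sub>x u\<close>:
    cyclic symmetry brings the projection of \<open>x\<close> into the last slot of each bracket
    form, where it can be moved across the pairing.\<close>
  define A where "A v = proj_plus ((1/3) *\<^sub>R dorfman br H (proj_plus u) (proj_plus v)
      + dorfman br H (proj_minus u) (proj_minus v))
    + proj_minus (dorfman br H (proj_plus u) (proj_plus v)
      + (1/3) *\<^sub>R dorfman br H (proj_minus u) (proj_minus v))" for v
  have A: "canonical_form x u y = pairing x (A y)" for x y
    by (simp add: A_def pairing_commute[of x] pairing_add_left pairing_proj_plus pairing_proj_minus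
        pairing_scale_left canonical_form_def bracket_form_def[symmetric]
        bracket_form_cyclic[of "_ u" "_ y" "_ x"])
  have "pairing_adjoint (\<lambda>w. canonical_connection w u) = A"
    by (rule pairing_adjointI) (simp add: pairing_canonical_connection A)
  then have "pairing (torsion br H canonical_connection u v) w =
      canonical_form u v w - canonical_form v u w - bracket_form u v w + canonical_form w u v"
    by (simp add: torsion_def pairing_add_left pairing_diff_left pairing_canonical_connection
        bracket_form_def A pairing_commute[of w])
  also have "\<dots> = 0"
    \<comment> \<open>Skewness in the last two slots turns the second term into
      \<open>+ canonical_form v w u\<close>, so the cyclic sum appears.\<close>
    using canonical_form_cyclic_sum[of u v w] canonical_form_swap23[of v w u] by simp
  finally show "pairing (torsion br H canonical_connection u v) w = pairing 0 w" by simp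
qed

lemma levi_civita_canonical_connection: "levi_civita br H g canonical_connection"
  unfolding levi_civita_def gen_connection_def
proof (intro conjI allI)
  show "pairing (canonical_connection u v) w = - pairing v (canonical_connection u w)" for u v w
    by (simp add: pairing_canonical_connection pairing_commute[of v] canonical_form_swap23[of u v w])
  have "canonical_connection u v \<in> E_plus g" if "v \<in> E_plus g" for u v
  proof -
    have "proj_minus v = 0"
      using that by (auto simp: E_plus_def)
    then show ?thesis
      by (simp add: canonical_connection_def linear_0[OF linear_proj_minus] proj_plus_in)
  qed
  then show "canonical_connection u ` E_plus g \<subseteq> E_plus g" for u
    by blast
  have "canonical_connection u v \<in> E_minus g" if "v \<in> E_minus g" for u v
  proof -
    have "proj_plus v = 0"
      using that by (auto simp: E_minus_def)
    then show ?thesis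
      by (simp add: canonical_connection_def linear_0[OF linear_proj_plus] proj_minus_in)
  qed
  then show "canonical_connection u ` E_minus g \<subseteq> E_minus g" for u
    by blast
qed (simp_all add: bilinear_canonical_connection torsion_canonical_connection)

text \<open>Each projection fixes or kills an adapted basis vector, so at most one of the four
  summands survives. If the last two vectors have different types, none does, which gives the zero
  coefficients.\<close>

lemma canonical_form_adapted_basis:
  assumes "A \<in> {1..2*n}" "B \<in> {1..2*n}" "C \<in> {1..2*n}"
  shows "canonical_form (adapted_basis n g v A) (adapted_basis n g v B) (adapted_basis n g v C)
    = omega n br H (adapted_basis n g v) A B C"
proof -
  have "proj_plus (adapted_basis n g v A) = (if A \<le> n then adapted_basis n g v A else 0)"
    "proj_minus (adapted_basis n g v A) = (if A \<le> n then 0 else adapted_basis n g v A)" for A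
    by (simp_all add: adapted_basis_def)
  then show ?thesis
    using assms by (simp add: canonical_form_def omega_def Let_def bracket_coeff_def bracket_form_def)
qed

subsection \<open>Adapted bases\<close>

text \<open>The two halves are \<open>orthonormal_expansion\<close> transported to
  \<open>E_plus\<close> and \<open>E_minus\<close>. The result serves for coefficients, for spanning
  and as the frame of the trace.\<close>

lemma adapted_expansion:
  assumes "orthonormal_basis n g v"
  defines "e \<equiv> adapted_basis n g v"
  shows "u = (\<Sum>A\<in>{1..2*n}. (pairing (e A) (e A) * pairing u (e A)) *\<^sub>R e A)"
proof -
  let ?F = "\<lambda>A. (pairing (e A) (e A) * pairing u (e A)) *\<^sub>R e A"
  have plus: "proj_plus u = (\<Sum>a\<in>{1..n}. ?F a)"
  proof -
    obtain X where X: "proj_plus u = (X, flat g X)"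
      using proj_plus_in[of u] by (auto simp: E_plus_def)
    have "pairing u (e a) = g X (v a)" "pairing (e a) (e a) = g (v a) (v a)" if "a \<in> {1..n}" for a
      using that pairing_proj_plus[of u "e a"] X
      by (simp_all add: e_def adapted_basis_def pairing_def g_commute)
    then have "(\<Sum>a\<in>{1..n}. ?F a) =
        (\<Sum>a\<in>{1..n}. (g (v a) (v a) * g X (v a)) *\<^sub>R (v a, flat g (v a)))"
      by (intro sum.cong) (auto simp: e_def adapted_basis_def)
    also have "\<dots> = (X, flat g X)"
      using orthonormal_expansion[OF metric assms(1), of X, symmetric]
      by (simp add: prod_eq_iff fst_sum snd_sum linear_simps(2)[symmetric] del: scaleR_scaleR
          flip: linear_sum[OF linear_flat])
    finally show ?thesis using X by simp
  qed
  have minus: "proj_minus u = (\<Sum>a\<in>{1..n}. ?F (a + n))"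
  proof -
    obtain X where X: "proj_minus u = (X, - flat g X)"
      using proj_minus_in[of u] by (auto simp: E_minus_def)
    \<comment> \<open>On \<open>E_minus\<close> the pairing is the negative of \<open>g\<close>; the
      two signs cancel in the product.\<close>
    have "pairing u (e (a + n)) = - g X (v a)" "pairing (e (a + n)) (e (a + n)) = - g (v a) (v a)"
      if "a \<in> {1..n}" for a
      using that pairing_proj_minus[of u "e (a + n)"] X
      by (simp_all add: e_def adapted_basis_def pairing_def g_commute)
    then have "(\<Sum>a\<in>{1..n}. ?F (a + n)) =
        (\<Sum>a\<in>{1..n}. (g (v a) (v a) * g X (v a)) *\<^sub>R (v a, - flat g (v a)))"
      by (intro sum.cong) (auto simp: e_def adapted_basis_def)
    also have "\<dots> = (X, - flat g X)"
      using orthonormal_expansion[OF metric assms(1), of X, symmetric]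
      by (simp add: prod_eq_iff fst_sum snd_sum sum_negf linear_simps(2)[symmetric] del: scaleR_scaleR
          flip: linear_sum[OF linear_flat])
    finally show ?thesis using X by simp
  qed
  have "(\<Sum>A\<in>{1..2*n}. ?F A) = (\<Sum>a\<in>{1..n}. ?F a) + (\<Sum>a\<in>{1..n}. ?F (a + n))"
    using sum.ub_add_nat[of 1 n ?F n] sum.shift_bounds_cl_nat_ivl[of ?F 1 n n]
    by (simp add: mult_2 add.commute)
  then show ?thesis using plus minus proj_add[of u] by simp
qed

lemma span_adapted_basis:
  assumes "orthonormal_basis n g v"
  shows "span (adapted_basis n g v ` {1..2*n}) = UNIV"
proof -
  have "u \<in> span (adapted_basis n g v ` {1..2*n})" for u
    by (subst adapted_expansion[OF assms]) (blast intro: span_sum span_scale span_base)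
  then show ?thesis by blast
qed

text \<open>The right-hand side does not mention \<open>v\<close>, so existence, uniqueness and
  independence of the basis all follow from this equivalence. A bilinear map is recovered from its
  coefficients by \<open>adapted_expansion\<close> and spanning.\<close>

lemma has_omega_coeffs_iff:
  assumes v: "orthonormal_basis n g v"
  shows "has_omega_coeffs n br H g v D \<longleftrightarrow> D = canonical_connection"
proof
  assume D: "has_omega_coeffs n br H g v D"
  let ?e = "adapted_basis n g v"
  have "D (?e A) (?e B) = canonical_connection (?e A) (?e B)" if "A \<in> {1..2*n}" "B \<in> {1..2*n}" for A B
  proof -
    have "pairing (D (?e A) (?e B)) (?e C) = pairing (canonical_connection (?e A) (?e B)) (?e C)"
      if "C \<in> {1..2*n}" for C
      using D that \<open>A \<in> _\<close> \<open>B \<in> _\<close>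
      by (simp add: has_omega_coeffs_def Let_def pairing_canonical_connection canonical_form_adapted_basis)
    then have "(\<Sum>C\<in>{1..2*n}. (pairing (?e C) (?e C) * pairing (D (?e A) (?e B)) (?e C)) *\<^sub>R ?e C) =
        (\<Sum>C\<in>{1..2*n}. (pairing (?e C) (?e C) * pairing (canonical_connection (?e A) (?e B)) (?e C)) *\<^sub>R ?e C)"
      by (intro sum.cong) simp_all
    then show ?thesis
      by (simp only: adapted_expansion[OF v, symmetric])
  qed
  then have eq: "D x y = canonical_connection x y"
    if "x \<in> ?e ` {1..2*n}" "y \<in> ?e ` {1..2*n}" for x y
    using that by blast
  have D': "bilinear D"
    using D by (simp add: has_omega_coeffs_def)
  have "UNIV \<subseteq> span (?e ` {1..2*n})"
    by (simp only: span_adapted_basis[OF v])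
  from bilinear_eq[OF D' bilinear_canonical_connection this this UNIV_I UNIV_I eq]
  have "D u w = canonical_connection u w" for u w .
  then show "D = canonical_connection" by (intro ext)
next
  assume "D = canonical_connection"
  then show "has_omega_coeffs n br H g v D"
    by (simp add: has_omega_coeffs_def Let_def bilinear_canonical_connection
        pairing_canonical_connection canonical_form_adapted_basis)
qed

lemma divergence_canonical_connection:
  assumes v: "orthonormal_basis n g v"
  shows "divergence canonical_connection w = 0"
proof -
  let ?e = "adapted_basis n g v"
  have "linear (\<lambda>u. pairing (?e A) (?e A) * pairing u (?e A))" for A
    by (rule linearI; simp add: pairing_simps algebra_simps)
  then have "divergence canonical_connection w =
      (\<Sum>A\<in>{1..2*n}. pairing (?e A) (?e A) * pairing (canonical_connection (?e A) w) (?e A))"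
    unfolding divergence_def
    using bilinear_canonical_connection
    by (intro lin_trace_dual_frame[where e = ?e] adapted_expansion[OF v])
      (simp_all add: bilinear_def del: split_paired_All)
  also have "\<dots> = 0"
    \<comment> \<open>One projection of each basis vector is zero, which kills the mixed terms; the
      pure ones repeat their first argument in the third slot.\<close>
    by (intro sum.neutral)
      (auto simp: adapted_basis_def pairing_canonical_connection canonical_form_def bracket_form_self13)
  finally show ?thesis .
qed

end

section \<open>The canonical divergence-free Levi-Civita generalized connection\<close>

theorem proposition2p15:
  fixes n :: nat
    and br :: "'a::real_vector \<Rightarrow> 'a \<Rightarrow> 'a"
    and H :: "'a \<Rightarrow> 'a \<Rightarrow> 'a \<Rightarrow> real"
    and g :: "'a \<Rightarrow> 'a \<Rightarrow> real"
  assumes dim_n: "\<exists>B :: 'a set. finite B \<and> independent B \<and> span B = UNIV \<and> card B = n"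
    and "lie_bracket br"
    and "closed_three_form br H"
    and "pseudo_metric g"
  shows "(\<forall>v. orthonormal_basis n g v \<longrightarrow> (\<exists>!D. has_omega_coeffs n br H g v D)) \<and>
    (\<forall>v D. orthonormal_basis n g v \<and> has_omega_coeffs n br H g v D \<longrightarrow>
       levi_civita br H g D \<and> (\<forall>w. divergence D w = 0)) \<and>
    (\<forall>v v' D D'. orthonormal_basis n g v \<and> orthonormal_basis n g v' \<and>
       has_omega_coeffs n br H g v D \<and> has_omega_coeffs n br H g v' D' \<longrightarrow> D = D')"
proof -
  \<comment> \<open>Every clause of the claim supplies an orthonormal basis, from which surjectivity
    of \<open>flat g\<close> is obtained.\<close>
  have "left_invariant_data br H g" if "orthonormal_basis n g v" for v
    using assms surj_flat[OF _ that]
    by (auto simp: left_invariant_data_def lie_bracket_def closed_three_form_def)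
  then show ?thesis
    by (auto simp: left_invariant_data.has_omega_coeffs_iff
        left_invariant_data.levi_civita_canonical_connection
        left_invariant_data.divergence_canonical_connection)
qed

end
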